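(* Let $\mathcal H_A,\mathcal H_B,\mathcal H_E$, the unitaries $U$ on $\mathcal H_A\otimes\mathcal H_E$ and $V$ on $\mathcal H_B\otimes\mathcal H_E$, the unit vectors $|\chi\rangle_E,|\tilde\chi\rangle_E\in\mathcal H_E$, the full-rank steady state $\sigma$ of $\mathcal F$, the conjugation $\theta$, the unitary $W$, and the state $|\psi\rangle_{AB}$ be as in the context. Then the reversal condition holds, i.e. there exists a unitary $U_E$ on $\mathcal H_E$ such that $$(I_A\otimes V)(I_{AB}\otimes U_E)(U\otimes I_B)\,|\psi\rangle_{AB}\otimes|\chi\rangle_E=|\psi\rangle_{AB}\otimes|\tilde\chi\rangle_E,$$ if and only if the maps $$\mathcal F\rho_A=\operatorname{tr}_E\left[U(\rho_A\otimes|\chi\rangle_E\langle\chi|)U^\dagger\right],\qquad \mathcal G\rho_B=\operatorname{tr}_E\left[V^\dagger(\rho_B\otimes|\tilde\chi\rangle_E\langle\tilde\chi|)V\right]$$ obey $$\mathcal G=\mathcal W\,\Theta\,\mathcal F^{\mathrm{Petz}}\,\Theta\,\mathcal W^{-1},$$ where $\mathcal F^{\mathrm{Petz}}$ is the Petz recovery map of $\mathcal F$ with respect to the steady state $\sigma=\mathcal F\sigma$.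
   Context: All Hilbert spaces are complex and finite-dimensional; $\mathcal O(\mathcal H)$ is the set of linear operators on $\mathcal H$; a map is an operator acting on operators. Inner products are antilinear in the first argument. $I_{xy\dots}$ is the identity on $\mathcal H_x\otimes\mathcal H_y\otimes\cdots$, and $\operatorname{tr}_x$ is the partial trace over $\mathcal H_x$. In products such as $(I_A\otimes V)(I_{AB}\otimes U_E)(U\otimes I_B)$ all operators act on $\mathcal H_A\otimes\mathcal H_B\otimes\mathcal H_E$, each operator acting on the tensor factors it is defined on and as the identity on the others. Setting: $\mathcal H_A,\mathcal H_B,\mathcal H_E$ are Hilbert spaces with $\dim\mathcal H_A=\dim\mathcal H_B=d$. $U$ is a unitary on $\mathcal H_A\otimes\mathcal H_E$, $V$ is a unitary on $\mathcal H_B\otimes\mathcal H_E$, and $|\chi\rangle_E,|\tilde\chi\rangle_E$ are unit vectors in $\mathcal H_E$. The completely positive trace-preserving (CPTP) maps $\mathcal F:\mathcal O(\mathcal H_A)\to\mathcal O(\mathcal H_A)$ and $\mathcal G:\mathcal O(\mathcal H_B)\to\mathcal O(\mathcal H_B)$ are those displayed in the claim. $\sigma\in\mathcal O(\mathcal H_A)$ is a density operator with $\mathcal F\sigma=\sigma$ and spectral form $\sigma=\sum_{n=0}^{d-1}p_n|n\rangle_A\langle n|$, where $\{|n\rangle_A\}$ is an orthonormal basis of $\mathcal H_A$ and $p_n>0$ for all $n$. An antiunitary operator $\theta$ on $\mathcal H_A$ is an antilinear operator with $\langle\theta\phi,\theta\psi\rangle=\langle\psi,\phi\rangle$ for all $\phi,\psi$;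 it is a conjugation if moreover $\theta^2=I_A$. Here $\theta$ is a conjugation on $\mathcal H_A$ and $W:\mathcal H_A\to\mathcal H_B$ is unitary. Put $|\tilde n\rangle_B=W\theta|n\rangle_A$ and $$|\psi\rangle_{AB}=\sum_n\sqrt{p_n}\,|n\rangle_A\otimes|\tilde n\rangle_B .$$ Maps: $\Theta X=\theta X\theta$ for $X\in\mathcal O(\mathcal H_A)$ (an antilinear map), and $\mathcal W:\mathcal O(\mathcal H_A)\to\mathcal O(\mathcal H_B)$, $\mathcal WX=WXW^\dagger$. Petz map: the Hilbert–Schmidt adjoint $\mathcal M^{\mathrm{HS}}$ of a linear map $\mathcal M$ is its adjoint with respect to $\langle Y,X\rangle=\operatorname{tr}(Y^\dagger X)$. For a full-rank density operator $\rho$, $\mathcal E_\rho X=\rho^{1/2}X\rho^{1/2}$. The Petz recovery map of $\mathcal F$ with respect to $\rho$ is $\mathcal F^{\mathrm{Petz}}=\mathcal E_\rho\,\mathcal F^{\mathrm{HS}}\,\mathcal E_{\mathcal F\rho}^{-1}$; with $\rho=\sigma=\mathcal F\sigma$ it is $\mathcal E_\sigma\mathcal F^{\mathrm{HS}}\mathcal E_\sigma^{-1}$. *)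

theory Defs
  imports "HOL-Analysis.Analysis"
begin

text \<open>
  Finite-dimensional Hilbert spaces are coordinate spaces \<open>complex ^ 'n\<close>, operators between
  them are matrices (\<open>complex ^ 'n ^ 'm\<close> maps \<open>complex ^ 'n\<close> to \<open>complex ^ 'm\<close>), and tensor
  products are indexed by pairs. The real inner product \<open>inner\<close> of the library on \<open>complex ^ 'n\<close>
  is only the real part of the Hilbert space inner product, so the latter is defined here,
  antilinear in the first argument.
\<close>

definition cinner :: "complex ^ 'n \<Rightarrow> complex ^ 'n \<Rightarrow> complex" where
  "cinner v w = (\<Sum>i\<in>UNIV. cnj (v $ i) * w $ i)"

definition unit_vector :: "complex ^ 'n \<Rightarrow> bool" where
  "unit_vector v \<longleftrightarrow> cinner v v = 1"

definition dagger :: "complex ^ 'n ^ 'm \<Rightarrow> complex ^ 'm ^ 'n" where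
  "dagger A = (\<chi> i j. cnj (A $ j $ i))"

definition unitary :: "complex ^ 'n ^ 'm \<Rightarrow> bool" where
  "unitary A \<longleftrightarrow> dagger A ** A = mat 1 \<and> A ** dagger A = mat 1"

definition ketbra :: "complex ^ 'm \<Rightarrow> complex ^ 'n \<Rightarrow> complex ^ 'n ^ 'm" where
  "ketbra v w = (\<chi> i j. v $ i * cnj (w $ j))"

definition positive_op :: "complex ^ 'n ^ 'n \<Rightarrow> bool" where
  "positive_op A \<longleftrightarrow> dagger A = A \<and> (\<forall>v. 0 \<le> Re (cinner v (A *v v)))"

definition density_op :: "complex ^ 'n ^ 'n \<Rightarrow> bool" where
  "density_op \<rho> \<longleftrightarrow> positive_op \<rho> \<and> trace \<rho> = 1"

definition orthonormal_basis :: "nat \<Rightarrow> (nat \<Rightarrow> complex ^ 'n) \<Rightarrow> bool" where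
  "orthonormal_basis d b \<longleftrightarrow>
     (\<forall>m<d. \<forall>n<d. cinner (b m) (b n) = (if m = n then 1 else 0)) \<and>
     vec.span (b ` {..<d}) = UNIV"

definition antiunitary :: "(complex ^ 'n \<Rightarrow> complex ^ 'n) \<Rightarrow> bool" where
  "antiunitary \<theta> \<longleftrightarrow>
     (\<forall>v w. \<theta> (v + w) = \<theta> v + \<theta> w) \<and>
     (\<forall>c v. \<theta> (c *s v) = cnj c *s \<theta> v) \<and>
     (\<forall>v w. cinner (\<theta> v) (\<theta> w) = cinner w v)"

definition conjugation :: "(complex ^ 'n \<Rightarrow> complex ^ 'n) \<Rightarrow> bool" where
  "conjugation \<theta> \<longleftrightarrow> antiunitary \<theta> \<and> (\<forall>v. \<theta> (\<theta> v) = v)"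

definition tensor_vec :: "complex ^ 'a \<Rightarrow> complex ^ 'b \<Rightarrow> complex ^ ('a::finite \<times> 'b::finite)"
    (infixr "\<otimes>\<^sub>v" 75) where
  "v \<otimes>\<^sub>v w = (\<chi> i. v $ fst i * w $ snd i)"

definition tensor_op ::
    "complex ^ 'c ^ 'a \<Rightarrow> complex ^ 'd ^ 'b
      \<Rightarrow> complex ^ ('c::finite \<times> 'd::finite) ^ ('a::finite \<times> 'b::finite)"
    (infixr "\<otimes>\<^sub>m" 75) where
  "A \<otimes>\<^sub>m B = (\<chi> i j. A $ fst i $ fst j * B $ snd i $ snd j)"

text \<open>
  The composite system ABE is indexed by \<open>('a \<times> 'b) \<times> 'e\<close>. The next two definitions extend an
  operator on AE by the identity on B, and an operator on BE by the identity on A.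
\<close>

definition ext_AE ::
    "complex ^ ('a::finite \<times> 'e::finite) ^ ('a \<times> 'e)
      \<Rightarrow> complex ^ (('a \<times> 'b::finite) \<times> 'e) ^ (('a \<times> 'b) \<times> 'e)"
  where "ext_AE M = (\<chi> i j. case (i, j) of (((a, b), e), ((a', b'), e')) \<Rightarrow>
     M $ (a, e) $ (a', e') * mat 1 $ b $ b')"

definition ext_BE ::
    "complex ^ ('b::finite \<times> 'e::finite) ^ ('b \<times> 'e)
      \<Rightarrow> complex ^ (('a::finite \<times> 'b) \<times> 'e) ^ (('a \<times> 'b) \<times> 'e)"
  where "ext_BE M = (\<chi> i j. case (i, j) of (((a, b), e), ((a', b'), e')) \<Rightarrow>
     mat 1 $ a $ a' * M $ (b, e) $ (b', e'))"

definition ptrace_snd :: "complex ^ ('a::finite \<times> 'e::finite) ^ ('a \<times> 'e) \<Rightarrow> complex ^ 'a ^ 'a" where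
  "ptrace_snd M = (\<chi> i j. \<Sum>k\<in>UNIV. M $ (i, k) $ (j, k))"

definition hs_inner :: "complex ^ 'n ^ 'n \<Rightarrow> complex ^ 'n ^ 'n \<Rightarrow> complex" where
  "hs_inner Y X = trace (dagger Y ** X)"

text \<open>
  For a linear map the adjoint exists and is unique; the definition by \<open>SOME\<close> follows that of
  \<open>adjoint\<close> in the library, which is adjoint to the real inner product.
\<close>

definition hs_adjoint ::
    "(complex ^ 'n ^ 'n \<Rightarrow> complex ^ 'm ^ 'm) \<Rightarrow> complex ^ 'm ^ 'm \<Rightarrow> complex ^ 'n ^ 'n" where
  "hs_adjoint M = (SOME M'. \<forall>X Y. hs_inner Y (M X) = hs_inner (M' Y) X)"

text \<open>The positive square root; meaningful for positive operators only.\<close>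

definition op_sqrt :: "complex ^ 'n ^ 'n \<Rightarrow> complex ^ 'n ^ 'n" where
  "op_sqrt \<rho> = (THE R. positive_op R \<and> R ** R = \<rho>)"

definition sqrt_sandwich :: "complex ^ 'n ^ 'n \<Rightarrow> complex ^ 'n ^ 'n \<Rightarrow> complex ^ 'n ^ 'n" where
  "sqrt_sandwich \<rho> X = op_sqrt \<rho> ** X ** op_sqrt \<rho>"

text \<open>
  The sandwich map is invertible as a function exactly on full-rank reference operators, so the
  Petz map is meaningful when both \<open>\<rho>\<close> and \<open>M \<rho>\<close> have full rank.
\<close>

definition petz ::
    "(complex ^ 'n ^ 'n \<Rightarrow> complex ^ 'm ^ 'm) \<Rightarrow> complex ^ 'n ^ 'n
      \<Rightarrow> complex ^ 'm ^ 'm \<Rightarrow> complex ^ 'n ^ 'n" where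
  "petz M \<rho> = sqrt_sandwich \<rho> \<circ> hs_adjoint M \<circ> inv (sqrt_sandwich (M \<rho>))"

text \<open>
  The operator \<open>\<theta> X \<theta>\<close>. It is linear when \<open>\<theta>\<close> is antilinear, so it is given by its matrix.
\<close>

definition theta_map ::
    "(complex ^ 'n \<Rightarrow> complex ^ 'n) \<Rightarrow> complex ^ 'n ^ 'n \<Rightarrow> complex ^ 'n ^ 'n" where
  "theta_map \<theta> X = matrix (\<lambda>v. \<theta> (X *v \<theta> v))"

definition unitary_map :: "complex ^ 'a ^ 'b \<Rightarrow> complex ^ 'a ^ 'a \<Rightarrow> complex ^ 'b ^ 'b" where
  "unitary_map W X = W ** X ** dagger W"

end

theory Submission
  imports Defs
begin

text \<open>
  Let \<open>K e = \<langle>e|U|chi\<rangle>\<close> and \<open>L e = \<langle>e|V\<^sup>\<dagger>|chi'\<rangle>\<close> be the Kraus operators of \<open>F\<close> and \<open>G\<close>. Read as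
  a matrix, \<open>\<psi>\<close> is the invertible operator \<open>\<Psi> = \<sigma>\<^sup>1\<^sup>/\<^sup>2 (W J)\<^sup>T\<close>, where \<open>J\<close> is the unitary matrix with
  \<open>\<theta> v = J (cnj v)\<close>. Moving \<open>V\<close> to the right and comparing components on E, the reversal condition
  says that \<open>UE\<close> mixes the family \<open>N e = (\<Psi>\<^sup>-\<^sup>1 (K e) \<Psi>)\<^sup>T\<close> into the family \<open>L\<close>. The operators
  \<open>N e\<close> are exactly Kraus operators of the transformed Petz map, and two Kraus families of equal
  size define the same map iff a unitary mixes one into the other.
\<close>

section \<open>Matrix algebra over the complex numbers\<close>

text \<open>Conjugation in the standard coordinates. Composing an antilinear map with
  \<open>vconj\<close> gives a linear one, so \<theta> can be handled by matrix algebra.\<close>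

definition mconj :: "complex ^ 'n ^ 'm \<Rightarrow> complex ^ 'n ^ 'm" where
  "mconj A = (\<chi> i j. cnj (A $ i $ j))"

definition vconj :: "complex ^ 'n \<Rightarrow> complex ^ 'n" where
  "vconj v = (\<chi> i. cnj (v $ i))"

lemma dagger_dagger [simp]: "dagger (dagger A) = A"
  by (simp add: dagger_def vec_eq_iff)

lemma dagger_one [simp]: "dagger (mat 1) = mat 1"
  by (auto simp: dagger_def mat_def vec_eq_iff)

lemma dagger_mult: "dagger (A ** B) = dagger B ** dagger A"
  by (simp add: dagger_def matrix_matrix_mult_def vec_eq_iff mult.commute)

lemma dagger_diff: "dagger (A - B) = dagger A - dagger B"
  by (simp add: dagger_def vec_eq_iff)

lemma dagger_sum: "dagger (\<Sum>i\<in>I. A i) = (\<Sum>i\<in>I. dagger (A i))"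
  by (simp add: dagger_def vec_eq_iff)

lemma dagger_scaleR: "dagger (c *\<^sub>R A) = c *\<^sub>R dagger A"
  by (simp add: dagger_def vec_eq_iff)

lemma dagger_ketbra [simp]: "dagger (ketbra v w) = ketbra w v"
  by (simp add: dagger_def ketbra_def vec_eq_iff)

lemma transpose_dagger: "transpose (dagger A) = mconj A"
  by (simp add: dagger_def transpose_def mconj_def vec_eq_iff)

lemma mconj_mconj [simp]: "mconj (mconj A) = A"
  by (simp add: mconj_def vec_eq_iff)

lemma mconj_mult: "mconj (A ** B) = mconj A ** mconj B"
  by (simp add: mconj_def matrix_matrix_mult_def vec_eq_iff)

lemma mconj_sum: "mconj (\<Sum>i\<in>I. A i) = (\<Sum>i\<in>I. mconj (A i))"
  by (simp add: mconj_def vec_eq_iff)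

lemma mconj_dagger: "mconj (dagger A) = transpose A"
  by (simp add: dagger_def transpose_def mconj_def vec_eq_iff)

lemma vconj_vconj [simp]: "vconj (vconj v) = v"
  by (simp add: vconj_def vec_eq_iff)

lemma vconj_mult: "vconj (A *v v) = mconj A *v vconj v"
  by (simp add: mconj_def vconj_def matrix_vector_mult_def vec_eq_iff)

lemma matrix_mult_sum_left: "(\<Sum>i\<in>I. A i) ** B = (\<Sum>i\<in>I. A i ** B)"
  for A :: "'i \<Rightarrow> complex ^ 'n ^ 'm"
  by (simp add: matrix_matrix_mult_def vec_eq_iff sum_distrib_right sum.swap[of _ UNIV I])

lemma matrix_mult_sum_right: "B ** (\<Sum>i\<in>I. A i) = (\<Sum>i\<in>I. B ** A i)"
  for A :: "'i \<Rightarrow> complex ^ 'n ^ 'm"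
  by (simp add: matrix_matrix_mult_def vec_eq_iff sum_distrib_left sum.swap[of _ UNIV I])

lemma matrix_vector_sum_left: "(\<Sum>i\<in>I. A i) *v v = (\<Sum>i\<in>I. A i *v v)"
  for A :: "'i \<Rightarrow> complex ^ 'n ^ 'm"
  by (simp add: matrix_vector_mult_def vec_eq_iff sum_distrib_right sum.swap[of _ UNIV I])

lemma matrix_scaleR_mult: "(c *\<^sub>R A) ** B = c *\<^sub>R (A ** B)"
  for A :: "complex ^ 'n ^ 'm"
  by (simp add: matrix_matrix_mult_def vec_eq_iff scaleR_sum_right)

lemma scaleR_matrix_vector: "(c *\<^sub>R A) *v v = c *\<^sub>R (A *v v)"
  for A :: "complex ^ 'n ^ 'm"
  by (simp add: matrix_vector_mult_def vec_eq_iff scaleR_sum_right)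

lemma matrix_mult_scaleR: "A ** (c *\<^sub>R B) = c *\<^sub>R (A ** B)"
  for A :: "complex ^ 'n ^ 'm"
  by (simp add: matrix_matrix_mult_def vec_eq_iff scaleR_sum_right)

lemma matrix_sub_rdistrib: "(B - C) ** A = B ** A - C ** A"
  for A :: "complex ^ 'n ^ 'm"
  by (simp add: matrix_matrix_mult_def vec_eq_iff sum_subtractf left_diff_distrib)

lemma matrix_sub_ldistrib: "A ** (B - C) = A ** B - A ** C"
  for A :: "complex ^ 'n ^ 'm"
  by (simp add: matrix_matrix_mult_def vec_eq_iff sum_subtractf right_diff_distrib)

lemma trace_mult_commute: "trace (A ** B) = trace (B ** A)"
  for A :: "complex ^ 'n ^ 'm" and B :: "complex ^ 'm ^ 'n"
proof -
  have "trace (A ** B) = (\<Sum>i\<in>UNIV. \<Sum>k\<in>UNIV. A $ i $ k * B $ k $ i)"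
    by (simp add: trace_def matrix_matrix_mult_def)
  also have "\<dots> = (\<Sum>k\<in>UNIV. \<Sum>i\<in>UNIV. A $ i $ k * B $ k $ i)"
    by (rule sum.swap)
  also have "\<dots> = trace (B ** A)"
    by (simp add: trace_def matrix_matrix_mult_def mult.commute)
  finally show ?thesis .
qed

lemma cancel_inverse_left: "A ** B = mat 1 \<Longrightarrow> A ** (B ** C) = C"
  for A :: "complex ^ 'n ^ 'm"
  by (simp add: matrix_mul_assoc)

section \<open>Rank-one operators and the complex inner product\<close>

lemma ketbra_mult: "ketbra u v ** ketbra w x = ketbra (cinner v w *s u) x"
  by (simp add: ketbra_def cinner_def matrix_matrix_mult_def vec_eq_iff
      sum_distrib_left sum_distrib_right mult_ac)

lemma ketbra_apply: "ketbra u v *v w = cinner v w *s u"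
  by (simp add: ketbra_def cinner_def matrix_vector_mult_def vec_eq_iff
      sum_distrib_left sum_distrib_right mult_ac)

lemma ketbra_zero [simp]: "ketbra 0 v = 0"
  by (simp add: ketbra_def vec_eq_iff)

lemma cinner_cnj: "cnj (cinner v w) = cinner w v"
  by (simp add: cinner_def mult.commute)

lemma cinner_diff_left: "cinner (v - w) x = cinner v x - cinner w x"
  by (simp add: cinner_def sum_subtractf ring_distribs)

lemma cinner_diff_right: "cinner v (w - x) = cinner v w - cinner v x"
  by (simp add: cinner_def sum_subtractf ring_distribs)

lemma cinner_scale_right: "cinner v (c *s w) = c * cinner v w"
  by (simp add: cinner_def sum_distrib_left mult_ac)

lemma cinner_scale_left: "cinner (c *s v) w = cnj c * cinner v w"
  by (simp add: cinner_def sum_distrib_left mult_ac)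

lemma cinner_scaleR_right: "cinner v (c *\<^sub>R w) = of_real c * cinner v w"
  by (simp add: cinner_def sum_distrib_left vector_scaleR_component)
    (simp add: scaleR_conv_of_real mult_ac)

lemma cinner_sum_right: "cinner v (\<Sum>i\<in>I. w i) = (\<Sum>i\<in>I. cinner v (w i))"
  by (simp add: cinner_def sum_distrib_left sum.swap[of _ UNIV I])

lemma cinner_self: "cinner v v = of_real (\<Sum>i\<in>UNIV. (cmod (v $ i))\<^sup>2)"
  by (simp add: cinner_def mult.commute[of "cnj _"] flip: complex_norm_square)

lemma cinner_self_eq_0: "cinner v v = 0 \<longleftrightarrow> v = 0"
  unfolding cinner_self of_real_eq_0_iff
  by (subst sum_nonneg_eq_0_iff) (auto simp: vec_eq_iff)

lemma cinner_mult_left: "cinner (A *v v) w = cinner v (dagger A *v w)"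
proof -
  have "cinner (A *v v) w = (\<Sum>i\<in>UNIV. \<Sum>j\<in>UNIV. cnj (v $ j) * (cnj (A $ i $ j) * w $ i))"
    by (simp add: cinner_def matrix_vector_mult_def sum_distrib_left sum_distrib_right mult_ac)
  also have "\<dots> = (\<Sum>j\<in>UNIV. \<Sum>i\<in>UNIV. cnj (v $ j) * (cnj (A $ i $ j) * w $ i))"
    by (rule sum.swap)
  also have "\<dots> = cinner v (dagger A *v w)"
    by (simp add: cinner_def dagger_def matrix_vector_mult_def sum_distrib_left)
  finally show ?thesis .
qed

lemma sum_mult_indicator:
  "(\<Sum>x\<in>UNIV. (if a = x then 1 else 0) * f x) = f a"
  "(\<Sum>x\<in>UNIV. f x * (if a = x then 1 else 0)) = f a"
  for f :: "'a::finite \<Rightarrow> complex"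
proof -
  have "(if a = x then 1 else 0) * f x = (if a = x then f x else 0)"
    and "f x * (if a = x then 1 else 0) = (if a = x then f x else 0)" for x by simp_all
  then show "(\<Sum>x\<in>UNIV. (if a = x then 1 else 0) * f x) = f a"
    and "(\<Sum>x\<in>UNIV. f x * (if a = x then 1 else 0)) = f a" by simp_all
qed

lemma matrix_mult_entry: "(A ** B) $ i $ j = (\<Sum>k\<in>UNIV. A $ i $ k * B $ k $ j)"
  by (simp add: matrix_matrix_mult_def)

lemma matrix_axis_apply: "(A *v axis k 1) $ i = A $ i $ k" for A :: "complex ^ 'n ^ 'm"
  by (simp add: matrix_vector_mult_def axis_def eq_commute[of _ k] sum_mult_indicator)

section \<open>Vectors with equal Gram matrices\<close>

lemma unitaryI:
  assumes "dagger A ** A = mat 1" shows "unitary (A :: complex ^ 'n ^ 'n)"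
  using assms matrix_left_right_inverse unfolding unitary_def by blast

lemma unitary_mult: "unitary A \<Longrightarrow> unitary B \<Longrightarrow> unitary (A ** B)"
  unfolding unitary_def dagger_mult by (metis matrix_mul_assoc matrix_mul_rid)

lemma unitary_cinner: "unitary A \<Longrightarrow> cinner (A *v v) (A *v w) = cinner v w"
  by (simp add: unitary_def cinner_mult_left matrix_vector_mul_assoc)

text \<open>The witness is the complex Householder reflection along \<open>z = x - y\<close> with the coefficient
  \<open>c = 1 / \<langle>z, x\<rangle>\<close>; it is unitary because \<open>\<langle>z, z\<rangle> = 2 Re \<langle>z, x\<rangle>\<close>.\<close>

lemma unitary_moving_vector:
  fixes x y :: "complex ^ 'n"
  assumes norm: "cinner x x = cinner y y"
  obtains H where "unitary H" "H *v x = y"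
    "\<And>v. cinner v x = cinner v y \<Longrightarrow> H *v v = v"
proof (cases "x = y")
  case True
  have "unitary (mat 1 :: complex ^ 'n ^ 'n)" by (simp add: unitary_def)
  then show ?thesis using that[of "mat 1"] True by simp
next
  case False
  define z where "z = x - y"
  define s where "s = cinner z x"
  define c where "c = 1 / s"
  define H where "H = mat 1 - ketbra (c *s z) z"
  have zz: "cinner z z = s + cnj s"
    by (simp add: s_def z_def cinner_cnj cinner_diff_left cinner_diff_right norm)
  have "cinner z z \<noteq> 0" using False by (simp add: cinner_self_eq_0 z_def)
  then have s0: "s \<noteq> 0" using zz by auto
  then have cc: "c * cnj c * cinner z z = c + cnj c"
    by (simp add: c_def zz field_simps)
  have "dagger H ** H = mat 1 - ketbra (c *s z) z - ketbra z (c *s z)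
      + ketbra (cinner (c *s z) (c *s z) *s z) z"
    by (simp add: H_def dagger_diff matrix_sub_rdistrib matrix_sub_ldistrib ketbra_mult)
  also have "\<dots> = mat 1"
  proof -
    have "cinner (c *s z) (c *s z) = c + cnj c"
      using cc by (simp add: cinner_scale_left cinner_scale_right mult_ac)
    then show ?thesis by (simp add: ketbra_def vec_eq_iff algebra_simps)
  qed
  finally have "unitary H" by (rule unitaryI)
  moreover have "H *v x = y"
    using s0 by (simp add: H_def matrix_vector_mult_diff_rdistrib ketbra_apply c_def z_def
        flip: s_def) (simp add: s_def z_def vec_eq_iff)
  \<comment> \<open>Such a \<open>v\<close> is orthogonal to \<open>z\<close>, and the reflection
    fixes the orthogonal complement of \<open>z\<close>.\<close>
  moreover have "H *v v = v" if "cinner v x = cinner v y" for v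
  proof -
    have "cinner z v = cnj (cinner v z)" by (simp add: cinner_cnj)
    also have "\<dots> = 0" using that by (simp add: z_def cinner_diff_right)
    finally show ?thesis by (simp add: H_def matrix_vector_mult_diff_rdistrib ketbra_apply)
  qed
  ultimately show ?thesis using that by blast
qed

text \<open>Vectors are placed one at a time. After \<open>Q\<close> has placed the earlier ones, a
  reflection \<open>H\<close> carries \<open>Q *v v k\<close> to \<open>w k\<close>. It leaves each
  earlier \<open>w i\<close> alone, because the Gram condition gives \<open>w i\<close> the same
  inner product with \<open>Q *v v k\<close> and with \<open>w k\<close>.\<close>

lemma equal_gram_imp_unitary:
  fixes v w :: "'i \<Rightarrow> complex ^ 'n"
  assumes "finite I"
    and "\<And>i j. i \<in> I \<Longrightarrow> j \<in> I \<Longrightarrow> cinner (v i) (v j) = cinner (w i) (w j)"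
  shows "\<exists>Q. unitary Q \<and> (\<forall>i\<in>I. Q *v v i = w i)"
  using assms
proof (induction I)
  case empty
  have "unitary (mat 1 :: complex ^ 'n ^ 'n)" by (simp add: unitary_def)
  then show ?case by auto
next
  case (insert k I)
  then obtain Q where Q: "unitary Q" "\<And>i. i \<in> I \<Longrightarrow> Q *v v i = w i" by auto
  have "cinner (Q *v v k) (Q *v v k) = cinner (w k) (w k)"
    using Q(1) insert.prems by (simp add: unitary_cinner)
  then obtain H where H: "unitary H" "H *v (Q *v v k) = w k"
    "\<And>u. cinner u (Q *v v k) = cinner u (w k) \<Longrightarrow> H *v u = u"
    by (rule unitary_moving_vector) blast
  have "H *v (Q *v v i) = w i" if "i \<in> I" for i
  proof -
    have "cinner (Q *v v i) (Q *v v k) = cinner (w i) (w k)"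
      using Q(1) insert.prems that by (simp add: unitary_cinner)
    then show ?thesis using H(3)[of "w i"] Q(2)[OF that] by simp
  qed
  then have "\<forall>i\<in>insert k I. (H ** Q) *v v i = w i"
    using H(2) by (auto simp: matrix_vector_mul_assoc[symmetric])
  then show ?case using unitary_mult[OF H(1) Q(1)] by blast
qed

section \<open>Kraus families\<close>

definition kraus_map :: "('e::finite \<Rightarrow> complex ^ 'n ^ 'm) \<Rightarrow> complex ^ 'n ^ 'n \<Rightarrow> complex ^ 'm ^ 'm"
  where "kraus_map K X = (\<Sum>e\<in>UNIV. K e ** X ** dagger (K e))"

text \<open>The matrix \<open>Q\<close> acts on the environment label only; matrix positions are
  spectators.\<close>

definition mix :: "complex ^ 'e ^ 'e \<Rightarrow> ('e \<Rightarrow> complex ^ 'n ^ 'm) \<Rightarrow> 'e \<Rightarrow> complex ^ 'n ^ 'm"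
  where "mix Q K e = (\<chi> i j. \<Sum>f\<in>UNIV. Q $ e $ f * K f $ i $ j)"

text \<open>For one matrix position, the entries over all labels form a vector of the environment
  space. The Gram matrix of these vectors is, up to the arrangement of indices, the Choi matrix of
  \<open>kraus_map K\<close>.\<close>

definition kraus_col :: "('e::finite \<Rightarrow> complex ^ 'n ^ 'm) \<Rightarrow> 'm \<times> 'n \<Rightarrow> complex ^ 'e"
  where "kraus_col K = (\<lambda>(i, j). \<chi> e. K e $ i $ j)"

definition kraus_op ::
    "complex ^ ('a::finite \<times> 'e::finite) ^ ('a \<times> 'e) \<Rightarrow> complex ^ 'e \<Rightarrow> 'e \<Rightarrow> complex ^ 'a ^ 'a"
  where "kraus_op U c e = (\<chi> i j. \<Sum>f\<in>UNIV. U $ (i, e) $ (j, f) * c $ f)"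

text \<open>The sum exchanges move the environment label innermost, which shows that the map depends
  on the family only through the Gram matrix of its columns.\<close>

lemma kraus_map_entry:
  "kraus_map K X $ i $ j = (\<Sum>k\<in>UNIV. \<Sum>l\<in>UNIV. X $ k $ l * cinner (kraus_col K (j, l)) (kraus_col K (i, k)))"
proof -
  have "kraus_map K X $ i $ j
      = (\<Sum>e\<in>UNIV. \<Sum>l\<in>UNIV. \<Sum>k\<in>UNIV. X $ k $ l * (cnj (K e $ j $ l) * K e $ i $ k))"
    by (simp add: kraus_map_def matrix_matrix_mult_def dagger_def sum_distrib_left sum_distrib_right mult_ac)
  also have "\<dots> = (\<Sum>l\<in>UNIV. \<Sum>e\<in>UNIV. \<Sum>k\<in>UNIV. X $ k $ l * (cnj (K e $ j $ l) * K e $ i $ k))"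
    by (rule sum.swap)
  also have "\<dots> = (\<Sum>l\<in>UNIV. \<Sum>k\<in>UNIV. \<Sum>e\<in>UNIV. X $ k $ l * (cnj (K e $ j $ l) * K e $ i $ k))"
    by (intro sum.cong refl sum.swap)
  also have "\<dots> = (\<Sum>k\<in>UNIV. \<Sum>l\<in>UNIV. \<Sum>e\<in>UNIV. X $ k $ l * (cnj (K e $ j $ l) * K e $ i $ k))"
    by (rule sum.swap)
  finally show ?thesis
    by (simp add: cinner_def kraus_col_def sum_distrib_left)
qed

lemma kraus_map_eq_iff:
  fixes K L :: "'e::finite \<Rightarrow> complex ^ 'n ^ 'm"
  shows "kraus_map K = kraus_map L \<longleftrightarrow>
    (\<forall>x y. cinner (kraus_col K x) (kraus_col K y) = cinner (kraus_col L x) (kraus_col L y))"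
proof
  assume eq: "kraus_map K = kraus_map L"
  \<comment> \<open>Evaluating on the matrix unit at position \<open>(k, l)\<close> isolates a
    single Gram entry.\<close>
  have *: "kraus_map K (\<chi> a b. if a = k \<and> b = l then 1 else 0) $ i $ j
      = cinner (kraus_col K (j, l)) (kraus_col K (i, k))"
    for K :: "'e \<Rightarrow> complex ^ 'n ^ 'm" and i j k l
  proof -
    have "(if a = k \<and> b = l then 1 else 0) * t = (if a = k then if b = l then t else 0 else 0)"
      for a b and t :: complex by simp
    then show ?thesis
      unfolding kraus_map_entry vec_lambda_beta
      by (simp add: sum.If_cases if_distrib[of "sum _"] cong: if_cong)
  qed
  show "\<forall>x y. cinner (kraus_col K x) (kraus_col K y) = cinner (kraus_col L x) (kraus_col L y)"
    using *[of K] *[of L] eq by (metis surj_pair)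
next
  assume "\<forall>x y. cinner (kraus_col K x) (kraus_col K y) = cinner (kraus_col L x) (kraus_col L y)"
  then show "kraus_map K = kraus_map L"
    by (intro ext) (simp add: vec_eq_iff kraus_map_entry)
qed

lemma kraus_col_mix: "kraus_col (mix Q K) x = Q *v kraus_col K x"
  by (cases x) (simp add: kraus_col_def mix_def matrix_vector_mult_def vec_eq_iff)

lemma kraus_col_inject: "(\<forall>x. kraus_col K x = kraus_col L x) \<longleftrightarrow> K = L"
  by (auto simp: kraus_col_def vec_eq_iff fun_eq_iff)

text \<open>Equality of the maps is equality of the Gram matrices of columns, and mixing is the
  action of \<open>Q\<close> on every column. Both families carry the same label type, so the
  vectors of equal Gram matrix lie in one space and a unitary relates them.\<close>

lemma kraus_unitary_freedom:
  "kraus_map K = kraus_map L \<longleftrightarrow> (\<exists>Q. unitary Q \<and> mix Q K = L)"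
proof
  assume "kraus_map K = kraus_map L"
  then show "\<exists>Q. unitary Q \<and> mix Q K = L"
    using equal_gram_imp_unitary[of UNIV "kraus_col K" "kraus_col L"]
    by (auto simp: kraus_map_eq_iff kraus_col_mix simp flip: kraus_col_inject)
next
  assume "\<exists>Q. unitary Q \<and> mix Q K = L"
  then show "kraus_map K = kraus_map L"
    by (auto simp: kraus_map_eq_iff kraus_col_mix unitary_cinner)
qed

lemma mix_mult_left: "mix Q (\<lambda>e. A ** K e) e = A ** mix Q K e"
proof -
  have "mix Q (\<lambda>e. A ** K e) e $ i $ j = (A ** mix Q K e) $ i $ j" for i j
  proof -
    have "mix Q (\<lambda>e. A ** K e) e $ i $ j
        = (\<Sum>f\<in>UNIV. \<Sum>k\<in>UNIV. A $ i $ k * (Q $ e $ f * K f $ k $ j))"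
      by (simp add: mix_def matrix_matrix_mult_def sum_distrib_left mult_ac)
    also have "\<dots> = (\<Sum>k\<in>UNIV. \<Sum>f\<in>UNIV. A $ i $ k * (Q $ e $ f * K f $ k $ j))"
      by (rule sum.swap)
    also have "\<dots> = (A ** mix Q K e) $ i $ j"
      by (simp add: mix_def matrix_matrix_mult_def sum_distrib_left)
    finally show ?thesis .
  qed
  then show ?thesis by (simp add: vec_eq_iff)
qed

lemma mix_transpose: "mix Q (\<lambda>e. transpose (K e)) e = transpose (mix Q K e)"
  by (simp add: mix_def transpose_def vec_eq_iff)

section \<open>The positive square root\<close>

lemma positive_op_dagger: "positive_op A \<Longrightarrow> dagger A = A"
  by (simp add: positive_op_def)

lemma trace_eq_sum_cinner: "trace A = (\<Sum>i\<in>UNIV. cinner (axis i 1) (A *v axis i 1))"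
  for A :: "complex ^ 'n ^ 'n"
proof -
  have "cinner (axis i 1) w = w $ i" for i and w :: "complex ^ 'n"
    by (simp add: cinner_def axis_def if_distrib[of cnj] eq_commute[of _ i] sum_mult_indicator
        cong: if_cong)
  then show ?thesis
    by (simp add: trace_def matrix_axis_apply)
qed

text \<open>With \<open>D = R - S\<close> one has \<open>S D + D R = 0\<close>, and taking the trace against \<open>D\<close> leaves
  \<open>tr (D S D) + tr (D R D) = 0\<close> with both terms nonnegative.\<close>

lemma positive_sqrt_unique:
  fixes R S :: "complex ^ 'n ^ 'n"
  assumes R: "positive_op R" and S: "positive_op S"
    and definite: "\<And>v. v \<noteq> 0 \<Longrightarrow> 0 < Re (cinner v (S *v v))"
    and eq: "R ** R = S ** S"
  shows "R = S"
proof -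
  define D where "D = R - S"
  have dD: "dagger D = D"
    using R S by (simp add: D_def dagger_diff positive_op_dagger)
  have "S ** D + D ** R = 0"
    by (simp add: D_def matrix_sub_ldistrib matrix_sub_rdistrib eq)
  then have "0 = trace (D ** (S ** D + D ** R))"
    by (simp add: trace_def)
  also have "\<dots> = trace (D ** S ** D) + trace (D ** (D ** R))"
    by (simp add: matrix_add_ldistrib matrix_mul_assoc trace_add)
  also have "trace (D ** (D ** R)) = trace (D ** R ** D)"
    by (rule trace_mult_commute)
  finally have tr: "0 = trace (D ** S ** D) + trace (D ** R ** D)" .
  \<comment> \<open>As \<open>D\<close> is self-adjoint, its left copy moves into the other
    argument, and each trace becomes a sum of expectation values in the vectors
    \<open>D *v axis i 1\<close>.\<close>
  have tr_eq: "Re (trace (D ** A ** D))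
      = (\<Sum>i\<in>UNIV. Re (cinner (D *v axis i 1) (A *v (D *v axis i 1))))" for A
    by (simp add: trace_eq_sum_cinner cinner_mult_left dD flip: matrix_vector_mul_assoc)
  have "0 \<le> Re (trace (D ** R ** D))"
    unfolding tr_eq using R by (auto simp: positive_op_def intro: sum_nonneg)
  moreover have Snn: "0 \<le> Re (cinner v (S *v v))" for v
    using S by (simp add: positive_op_def)
  moreover have "0 \<le> Re (trace (D ** S ** D))"
    unfolding tr_eq using Snn by (auto intro: sum_nonneg)
  moreover have "Re (trace (D ** S ** D)) + Re (trace (D ** R ** D)) = 0"
    using tr by (metis plus_complex.sel(1) zero_complex.sel(1))
  ultimately have "Re (trace (D ** S ** D)) = 0" by linarith
  then have "Re (cinner (D *v axis i 1) (S *v (D *v axis i 1))) = 0" for i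
    unfolding tr_eq using Snn by (subst (asm) sum_nonneg_eq_0_iff) auto
  then have "D *v axis i 1 = 0" for i
    using definite by (metis less_irrefl)
  then have "D = 0"
    by (metis matrix_axis_apply vec_eq_iff zero_index)
  then show ?thesis by (simp add: D_def)
qed

text \<open>The description in \<open>op_sqrt\<close> ranges over all positive roots; definiteness
  of the one root \<open>S\<close> excludes every other.\<close>

lemma op_sqrt_eq:
  assumes "positive_op S" "\<And>v. v \<noteq> 0 \<Longrightarrow> 0 < Re (cinner v (S *v v))"
  shows "op_sqrt (S ** S) = S"
  unfolding op_sqrt_def using assms positive_sqrt_unique by (intro the_equality) auto

section \<open>Operators diagonal in an orthonormal basis\<close>

definition spectral_op :: "nat \<Rightarrow> (nat \<Rightarrow> complex ^ 'n) \<Rightarrow> (nat \<Rightarrow> real) \<Rightarrow> complex ^ 'n ^ 'n" where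
  "spectral_op d b p = (\<Sum>n<d. p n *\<^sub>R ketbra (b n) (b n))"

lemma spectral_op_apply: "cinner v (spectral_op d b p *v v)
    = of_real (\<Sum>n<d. p n * (cmod (cinner (b n) v))\<^sup>2)"
proof -
  have "spectral_op d b p *v v = (\<Sum>n<d. p n *\<^sub>R (cinner (b n) v *s b n))"
    by (simp add: spectral_op_def matrix_vector_sum_left scaleR_matrix_vector
        ketbra_apply)
  also have "cinner v \<dots> = (\<Sum>n<d. of_real (p n) * (cinner (b n) v * cnj (cinner (b n) v)))"
    by (simp add: cinner_sum_right cinner_scaleR_right cinner_scale_right cinner_cnj)
  finally show ?thesis by (simp flip: complex_norm_square)
qed

text \<open>Orthonormality kills the cross terms, so products are computed on coefficients. This
  yields both the square root of \<sigma> and the inverse of that root.\<close>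

lemma spectral_op_mult:
  assumes "orthonormal_basis d b"
  shows "spectral_op d b p ** spectral_op d b q = spectral_op d b (\<lambda>n. p n * q n)"
proof -
  have "(\<Sum>m<d. (p n *\<^sub>R ketbra (b n) (b n)) ** (q m *\<^sub>R ketbra (b m) (b m)))
      = (p n * q n) *\<^sub>R ketbra (b n) (b n)" if "n < d" for n
  proof -
    have "(p n *\<^sub>R ketbra (b n) (b n)) ** (q m *\<^sub>R ketbra (b m) (b m))
        = (if m = n then (p n * q n) *\<^sub>R ketbra (b n) (b n) else 0)" if "m < d" for m
      using assms \<open>n < d\<close> that
      by (simp add: orthonormal_basis_def matrix_scaleR_mult matrix_mult_scaleR ketbra_mult)
    then show ?thesis using that by simp
  qed
  then show ?thesis
    unfolding spectral_op_def matrix_mult_sum_left unfolding matrix_mult_sum_right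
    by (intro sum.cong) auto
qed

lemma spectral_op_one:
  assumes "orthonormal_basis d b"
  shows "spectral_op d b (\<lambda>n. 1) = mat 1"
proof -
  have fixed: "spectral_op d b (\<lambda>n. 1) *v b m = b m" if "m < d" for m
  proof -
    have "spectral_op d b (\<lambda>n. 1) *v b m = (\<Sum>n<d. cinner (b n) (b m) *s b n)"
      by (simp add: spectral_op_def matrix_vector_sum_left ketbra_apply)
    also have "\<dots> = (\<Sum>n<d. if n = m then b m else 0)"
      using assms that by (intro sum.cong) (auto simp: orthonormal_basis_def)
    finally show ?thesis using that by simp
  qed
  \<comment> \<open>Both sides are linear in \<open>v\<close> and agree on the basis, hence on its
    span.\<close>
  have "spectral_op d b (\<lambda>n. 1) *v v = v" for v
  proof -
    have "v \<in> vec.span (b ` {..<d})"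
      using assms by (simp add: orthonormal_basis_def)
    then show ?thesis
      by (induction rule: vec.span_induct_alt)
        (auto simp: matrix_vector_right_distrib vector_scalar_commute fixed)
  qed
  then show ?thesis by (simp add: matrix_eq)
qed

text \<open>By completeness a nonzero \<open>v\<close> has some nonzero coefficient, and its weight
  is strictly positive.\<close>

lemma spectral_op_definite:
  assumes "orthonormal_basis d b" "\<And>n. n < d \<Longrightarrow> 0 < p n" "v \<noteq> 0"
  shows "0 < Re (cinner v (spectral_op d b p *v v))"
proof -
  have "(\<Sum>n<d. (cmod (cinner (b n) v))\<^sup>2) \<noteq> 0"
  proof
    assume "(\<Sum>n<d. (cmod (cinner (b n) v))\<^sup>2) = 0"
    then have "cinner v (spectral_op d b (\<lambda>n. 1) *v v) = 0"
      by (simp only: spectral_op_apply) simp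
    then show False
      using assms by (simp add: spectral_op_one cinner_self_eq_0)
  qed
  then obtain n where "n < d" "cinner (b n) v \<noteq> 0"
    by (metis (mono_tags, lifting) lessThan_iff norm_zero power_zero_numeral sum.neutral)
  then have "0 < (\<Sum>n<d. p n * (cmod (cinner (b n) v))\<^sup>2)"
    using assms(2) by (intro sum_pos2[of _ n]) (auto simp: less_imp_le)
  then show ?thesis by (simp add: spectral_op_apply)
qed

lemma spectral_op_dagger: "dagger (spectral_op d b p) = spectral_op d b p"
  by (simp add: spectral_op_def dagger_sum dagger_scaleR)

lemma spectral_op_positive: "(\<And>n. n < d \<Longrightarrow> 0 \<le> p n) \<Longrightarrow> positive_op (spectral_op d b p)"
  by (auto simp: positive_op_def spectral_op_dagger spectral_op_apply intro!: sum_nonneg)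

lemma op_sqrt_spectral_op:
  assumes "orthonormal_basis d b" "\<And>n. n < d \<Longrightarrow> 0 < p n"
  shows "op_sqrt (spectral_op d b p) = spectral_op d b (\<lambda>n. sqrt (p n))"
proof -
  have "spectral_op d b p = spectral_op d b (\<lambda>n. sqrt (p n) * sqrt (p n))"
    unfolding spectral_op_def using assms(2) by (intro sum.cong) (auto simp: less_imp_le)
  also have "\<dots> = spectral_op d b (\<lambda>n. sqrt (p n)) ** spectral_op d b (\<lambda>n. sqrt (p n))"
    by (simp add: spectral_op_mult[OF assms(1)])
  also have "op_sqrt \<dots> = spectral_op d b (\<lambda>n. sqrt (p n))"
    using assms by (intro op_sqrt_eq spectral_op_positive spectral_op_definite)
      (auto simp: less_imp_le)
  finally show ?thesis .
qed

section \<open>The Petz map and the antiunitary\<close>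

text \<open>Matrix units as test operators read off the conjugated entries. This makes the adjoint
  unique, so the choice in \<open>hs_adjoint\<close> can be evaluated.\<close>

lemma hs_inner_nondegenerate:
  assumes "\<And>X. hs_inner A X = hs_inner B X" shows "A = B"
proof -
  have "hs_inner C (\<chi> k l. if k = i \<and> l = j then 1 else 0) = cnj (C $ i $ j)" for C i j
  proof -
    have "cnj (C $ k $ l) * (if k = i \<and> l = j then 1 else 0)
        = (if k = i then if l = j then cnj (C $ i $ j) else 0 else 0)" for k l by simp
    then show ?thesis
      by (simp add: hs_inner_def trace_def matrix_matrix_mult_def dagger_def)
  qed
  then have "cnj (A $ i $ j) = cnj (B $ i $ j)" for i j
    using assms by metis
  then show ?thesis by (simp add: vec_eq_iff)
qed

lemma hs_adjoint_unique:
  assumes "\<And>X Y. hs_inner Y (M X) = hs_inner (N Y) X"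
  shows "hs_adjoint M = N"
  unfolding hs_adjoint_def
proof (rule some_equality)
  show "\<forall>X Y. hs_inner Y (M X) = hs_inner (N Y) X" using assms by simp
next
  fix N' assume "\<forall>X Y. hs_inner Y (M X) = hs_inner (N' Y) X"
  then show "N' = N" using assms by (intro ext hs_inner_nondegenerate) metis
qed

lemma trace_sum: "trace (\<Sum>i\<in>I. A i) = (\<Sum>i\<in>I. trace (A i))"
  for A :: "'i \<Rightarrow> complex ^ 'n ^ 'n"
  by (simp add: trace_def sum.swap[of _ UNIV I])

text \<open>Cyclicity of the trace moves each Kraus operator to the other argument as its
  adjoint.\<close>

lemma hs_adjoint_kraus_map: "hs_adjoint (kraus_map K) = kraus_map (\<lambda>e. dagger (K e))"
proof (rule hs_adjoint_unique)
  fix X Y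
  have "trace (dagger Y ** (K e ** X ** dagger (K e)))
      = trace (dagger (dagger (K e) ** Y ** K e) ** X)" for e
    by (metis trace_mult_commute matrix_mul_assoc dagger_mult dagger_dagger)
  then show "hs_inner Y (kraus_map K X) = hs_inner (kraus_map (\<lambda>e. dagger (K e)) Y) X"
    by (simp add: hs_inner_def kraus_map_def matrix_mult_sum_left matrix_mult_sum_right
        dagger_sum trace_sum)
qed

lemma inv_sandwich:
  assumes "S ** S' = mat 1" "S' ** S = mat 1"
  shows "inv (\<lambda>X. S ** X ** S) = (\<lambda>X. S' ** X ** S' :: complex ^ 'n ^ 'n)"
  by (rule inv_equality) (simp_all add: matrix_mul_assoc[symmetric] assms,
      simp_all add: matrix_mul_assoc assms)

lemma inv_unitary_map:
  assumes "unitary W" shows "inv (unitary_map W) = unitary_map (dagger W)"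
proof (rule inv_equality)
  fix X
  have "dagger W ** (W ** X ** dagger W) ** W = (dagger W ** W) ** X ** (dagger W ** W)"
    by (simp add: matrix_mul_assoc)
  then show "unitary_map (dagger W) (unitary_map W X) = X"
    using assms by (simp add: unitary_map_def unitary_def)
next
  fix X
  have "W ** (dagger W ** X ** W) ** dagger W = (W ** dagger W) ** X ** (W ** dagger W)"
    by (simp add: matrix_mul_assoc)
  then show "unitary_map W (unitary_map (dagger W) X) = X"
    using assms by (simp add: unitary_map_def unitary_def)
qed

text \<open>Since \<sigma> is a fixed point, the outer and the inverted sandwich use the same root.
  Self-adjointness of \<open>S\<close> and \<open>S'\<close> makes the sandwiched terms Kraus terms
  again.\<close>

lemma petz_kraus_map:
  assumes "kraus_map K \<sigma> = \<sigma>" "op_sqrt \<sigma> = S"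
    and "S ** S' = mat 1" "S' ** S = mat 1" "dagger S = S" "dagger S' = S'"
  shows "petz (kraus_map K) \<sigma> = kraus_map (\<lambda>e. S ** dagger (K e) ** S')"
proof -
  have "sqrt_sandwich \<sigma> = (\<lambda>X. S ** X ** S)"
    using assms(2) by (auto simp: sqrt_sandwich_def)
  then show ?thesis
    using assms(1)
    by (intro ext) (simp add: petz_def inv_sandwich[OF assms(3,4)] hs_adjoint_kraus_map kraus_map_def
        matrix_mult_sum_left matrix_mult_sum_right dagger_mult assms(5,6) matrix_mul_assoc)
qed

text \<open>The map \<open>\<lambda>v. \<theta> (vconj v)\<close> is linear, which provides
  \<open>J\<close>. Antiunitarity makes \<open>J\<close> unitary, and the involution property gives
  \<open>J ** mconj J = mat 1\<close>; so \<open>mconj J\<close> and \<open>dagger J\<close> are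
  both the inverse of \<open>J\<close>.\<close>

lemma conjugation_matrix:
  assumes "conjugation \<theta>"
  obtains J where "\<theta> = (\<lambda>v. J *v vconj v)" "unitary J" "mconj J = dagger J"
proof -
  define J where "J = matrix (\<lambda>v. \<theta> (vconj v))"
  have add: "\<theta> (v + w) = \<theta> v + \<theta> w" and scale: "\<theta> (c *s v) = cnj c *s \<theta> v"
    and inner: "cinner (\<theta> v) (\<theta> w) = cinner w v" and invol: "\<theta> (\<theta> v) = v" for v w c
    using assms by (auto simp: conjugation_def antiunitary_def)
  have vc: "vconj (v + w) = vconj v + vconj w" "vconj (c *s v) = cnj c *s vconj v"
    for v w :: "complex ^ 'a" and c
    by (simp_all add: vconj_def vec_eq_iff)
  have "Vector_Spaces.linear (*s) (*s) (\<lambda>v. \<theta> (vconj v))"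
    by unfold_locales (auto simp: add scale vc vector_space_over_itself.scale_left_distrib
        vec.scale_right_distrib)
  then have "J *v v = \<theta> (vconj v)" for v
    unfolding J_def by (simp add: matrix_works)
  then have J: "\<theta> v = J *v vconj v" for v by simp
  have "J ** mconj J = mat 1"
    using invol by (simp add: matrix_eq J vconj_mult flip: matrix_vector_mul_assoc)

  moreover have "dagger J ** J = mat 1"
  proof -
    \<comment> \<open>Taking \<open>v\<close> to be the difference itself will then force it to
      vanish.\<close>
    have "cinner v ((dagger J ** J) *v w - w) = 0" for v w
    proof -
      have "cinner v ((dagger J ** J) *v w) = cinner (J *v v) (J *v w)"
        by (simp add: cinner_mult_left matrix_vector_mul_assoc)
      also have "\<dots> = cinner (vconj w) (vconj v)"
        using inner[of "vconj v" "vconj w"] by (simp add: J)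
      also have "\<dots> = cinner v w" by (simp add: cinner_def vconj_def mult.commute)
      finally show ?thesis by (simp add: cinner_diff_right)
    qed
    then have "(dagger J ** J) *v w = w" for w
      using cinner_self_eq_0 by (metis eq_iff_diff_eq_0)
    then show ?thesis by (simp add: matrix_eq)
  qed
  ultimately have "mconj J = dagger J"
    by (metis matrix_mul_assoc matrix_mul_lid matrix_mul_rid)
  with that J \<open>dagger J ** J = mat 1\<close> show ?thesis
    by (metis (no_types, lifting) ext unitaryI)
qed

lemma theta_map_eq: "theta_map (\<lambda>v. J *v vconj v) X = J ** mconj X ** mconj J"
  by (simp add: theta_map_def vconj_mult mconj_mult matrix_vector_mul_assoc matrix_mul_assoc)

text \<open>The input is conjugated twice and so enters linearly, whereas each Kraus operator is
  conjugated once, by the outer \<open>theta_map\<close>. The factors of \<open>J\<close> and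
  \<open>W\<close> combine into one unitary around it.\<close>

lemma kraus_map_time_reversed:
  assumes "unitary J" "mconj J = dagger J"
  shows "(unitary_map W \<circ> theta_map (\<lambda>v. J *v vconj v) \<circ> kraus_map P
      \<circ> theta_map (\<lambda>v. J *v vconj v) \<circ> unitary_map (dagger W))
    = kraus_map (\<lambda>e. (W ** J) ** mconj (P e) ** dagger (W ** J))"
proof
  fix X
  have JJ: "mconj (dagger J) = J" using assms by (metis mconj_mconj)
  have md: "mconj (dagger A) = dagger (mconj A)" for A :: "complex ^ 'a ^ 'a"
    by (simp add: mconj_def dagger_def vec_eq_iff)
  show "(unitary_map W \<circ> theta_map (\<lambda>v. J *v vconj v) \<circ> kraus_map P
      \<circ> theta_map (\<lambda>v. J *v vconj v) \<circ> unitary_map (dagger W)) X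
    = kraus_map (\<lambda>e. (W ** J) ** mconj (P e) ** dagger (W ** J)) X"
    by (simp add: unitary_map_def theta_map_eq kraus_map_def mconj_sum mconj_mult JJ
        assms(2) md matrix_mult_sum_left matrix_mult_sum_right dagger_mult matrix_mul_assoc)
qed

section \<open>Dilations and their Kraus operators\<close>

lemma sum_UNIV_pair: "(\<Sum>x\<in>UNIV. f x) = (\<Sum>a\<in>UNIV. \<Sum>b\<in>UNIV. f (a, b))"
  for f :: "'a::finite \<times> 'b::finite \<Rightarrow> complex"
  unfolding UNIV_Times_UNIV[symmetric] sum.cartesian_product by (simp add: case_prod_beta)

lemma ptrace_dilation: "ptrace_snd (U ** (\<rho> \<otimes>\<^sub>m ketbra c c) ** dagger U) = kraus_map (kraus_op U c) \<rho>"
proof -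
  have entry: "(U ** (\<rho> \<otimes>\<^sub>m ketbra c c) ** dagger U) $ (i, e) $ (j, e)
      = (kraus_op U c e ** \<rho> ** dagger (kraus_op U c e)) $ i $ j" for i j e
  proof -
    \<comment> \<open>The ket of the environment state is absorbed into the Kraus operator. The
      remaining bra factor \<open>cnj (c $ h)\<close> is absorbed by \<open>dagger U\<close>
      below.\<close>
    have *: "(U ** (\<rho> \<otimes>\<^sub>m ketbra c c)) $ (i, e) $ (l, h)
        = (kraus_op U c e ** \<rho>) $ i $ l * cnj (c $ h)" for l h
      by (simp add: matrix_matrix_mult_def sum_UNIV_pair tensor_op_def ketbra_def kraus_op_def
          sum_distrib_left sum_distrib_right mult_ac)
    have "(U ** (\<rho> \<otimes>\<^sub>m ketbra c c) ** dagger U) $ (i, e) $ (j, e)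
        = (\<Sum>l\<in>UNIV. \<Sum>h\<in>UNIV. (kraus_op U c e ** \<rho>) $ i $ l * cnj (c $ h)
            * cnj (U $ (j, e) $ (l, h)))"
      by (subst matrix_mult_entry)
        (simp add: sum_UNIV_pair dagger_def *)
    also have "\<dots> = (\<Sum>l\<in>UNIV. (kraus_op U c e ** \<rho>) $ i $ l
        * dagger (kraus_op U c e) $ l $ j)"
    proof -
      have "dagger (kraus_op U c e) $ l $ j = (\<Sum>h\<in>UNIV. cnj (c $ h) * cnj (U $ (j, e) $ (l, h)))" for l
        by (simp add: dagger_def kraus_op_def mult_ac)
      then show ?thesis by (simp add: sum_distrib_left mult_ac)
    qed
    finally show ?thesis
      by (subst matrix_mult_entry)
  qed
  show ?thesis
    by (simp add: ptrace_snd_def entry kraus_map_def vec_eq_iff)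
qed

text \<open>In this form an operator on the first factor multiplies from the left, and one on the
  second factor multiplies from the right by its transpose.\<close>

definition vec_matrix :: "complex ^ ('a::finite \<times> 'b::finite) \<Rightarrow> complex ^ 'b ^ 'a" where
  "vec_matrix v = (\<chi> a b. v $ (a, b))"

lemma ext_AE_apply:
  "(ext_AE U *v (\<psi> \<otimes>\<^sub>v c)) $ ((a, b), e) = (kraus_op U c e ** vec_matrix \<psi>) $ a $ b"
proof -
  have "(ext_AE U *v (\<psi> \<otimes>\<^sub>v c)) $ ((a, b), e)
      = (\<Sum>a'\<in>UNIV. \<Sum>b'\<in>UNIV. (if b = b' then 1 else 0)
          * (\<Sum>f\<in>UNIV. U $ (a, e) $ (a', f) * (\<psi> $ (a', b') * c $ f)))"
    by (simp add: matrix_vector_mult_def sum_UNIV_pair ext_AE_def tensor_vec_def mat_def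
        sum_distrib_left mult_ac)
  then show ?thesis
    unfolding sum_mult_indicator
    by (simp add: matrix_matrix_mult_def kraus_op_def vec_matrix_def
        sum_distrib_left sum_distrib_right mult_ac)
qed

lemma ext_BE_apply:
  "(ext_BE V *v (\<psi> \<otimes>\<^sub>v c)) $ ((a, b), e)
    = (vec_matrix \<psi> ** transpose (kraus_op V c e)) $ a $ b"
proof -
  have "(ext_BE V *v (\<psi> \<otimes>\<^sub>v c)) $ ((a, b), e)
      = (\<Sum>a'\<in>UNIV. (if a = a' then 1 else 0) * (\<Sum>b'\<in>UNIV.
          \<Sum>f\<in>UNIV. V $ (b, e) $ (b', f) * (\<psi> $ (a', b') * c $ f)))"
    by (simp add: matrix_vector_mult_def sum_UNIV_pair ext_BE_def tensor_vec_def mat_def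
        sum_distrib_left mult_ac)
  then show ?thesis
    unfolding sum_mult_indicator
    by (simp add: matrix_matrix_mult_def kraus_op_def vec_matrix_def
        transpose_def sum_distrib_left mult_ac)
qed

lemma tensor_one_apply:
  "((mat 1 \<otimes>\<^sub>m Q) *v z) $ (x, e) = (\<Sum>f\<in>UNIV. Q $ e $ f * z $ (x, f))"
proof -
  have "((mat 1 \<otimes>\<^sub>m Q) *v z) $ (x, e)
      = (\<Sum>x'\<in>UNIV. (if x = x' then 1 else 0) * (\<Sum>f\<in>UNIV. Q $ e $ f * z $ (x', f)))"
    by (simp add: matrix_vector_mult_def sum_UNIV_pair tensor_op_def mat_def
        sum_distrib_left mult_ac)
  then show ?thesis by (simp only: sum_mult_indicator)
qed

lemma ext_BE_entry:
  "ext_BE M $ ((a, b), e) $ ((a', b'), e') = (if a = a' then 1 else 0) * M $ (b, e) $ (b', e')"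
  by (simp add: ext_BE_def mat_def)

text \<open>Used to see that extending \<open>dagger V\<close> inverts the extension of
  \<open>V\<close>.\<close>

lemma ext_BE_mult:
  "ext_BE M ** ext_BE N
    = (ext_BE (M ** N) :: complex ^ (('a::finite \<times> 'b::finite) \<times> 'e::finite) ^ (('a \<times> 'b) \<times> 'e))"
proof -
  have "(ext_BE M ** ext_BE N) $ ((a, b), e) $ ((a', b'), e')
      = ext_BE (M ** N) $ ((a, b), e) $ ((a', b'), e')" for a a' :: 'a and b e b' e'
  proof -
    have "(ext_BE M ** ext_BE N) $ ((a, b), e) $ ((a', b'), e')
        = (\<Sum>x\<in>UNIV. (if a = x then 1 else 0) * ((if x = a' then 1 else 0)
            * (M ** N) $ (b, e) $ (b', e')))"
      by (simp add: matrix_mult_entry sum_UNIV_pair ext_BE_entry sum_distrib_left mult_ac)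
    then show ?thesis
      unfolding sum_mult_indicator ext_BE_entry .
  qed
  then show ?thesis by (simp add: vec_eq_iff)
qed

lemma ext_BE_one: "ext_BE (mat 1) = mat 1"
  by (auto simp: ext_BE_def mat_def vec_eq_iff)

text \<open>The unitary \<open>V\<close> is moved to the right-hand side, where its adjoint acts on
  the target state. In both vectors the component at environment label \<open>e\<close> is then an
  operator product with the matrix of \<psi>, and \<open>Q\<close> only mixes the labels.\<close>

lemma reversal_iff_mix:
  fixes U :: "complex ^ ('a::finite \<times> 'e::finite) ^ ('a \<times> 'e)"
    and V :: "complex ^ ('b::finite \<times> 'e) ^ ('b \<times> 'e)"
  assumes "unitary V"
  shows "(ext_BE V ** (mat 1 \<otimes>\<^sub>m Q) ** ext_AE U) *v (\<psi> \<otimes>\<^sub>v c) = \<psi> \<otimes>\<^sub>v c'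
    \<longleftrightarrow> (\<forall>e. mix Q (\<lambda>e. kraus_op U c e ** vec_matrix \<psi>) e
          = vec_matrix \<psi> ** transpose (kraus_op (dagger V) c' e))"
proof -
  define B where "B = (ext_BE V :: complex ^ (('a \<times> 'b) \<times> 'e) ^ (('a \<times> 'b) \<times> 'e))"
  define B' where "B' = (ext_BE (dagger V) :: complex ^ (('a \<times> 'b) \<times> 'e) ^ (('a \<times> 'b) \<times> 'e))"
  have inv: "B ** B' = mat 1" "B' ** B = mat 1"
    using assms by (simp_all add: B_def B'_def ext_BE_mult unitary_def ext_BE_one)
  have "B *v x = y \<longleftrightarrow> x = B' *v y" for x y
    using inv by (auto simp: matrix_vector_mul_assoc)
  then have "(ext_BE V ** (mat 1 \<otimes>\<^sub>m Q) ** ext_AE U) *v (\<psi> \<otimes>\<^sub>v c) = \<psi> \<otimes>\<^sub>v c'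
    \<longleftrightarrow> (mat 1 \<otimes>\<^sub>m Q) *v (ext_AE U *v (\<psi> \<otimes>\<^sub>v c)) = ext_BE (dagger V) *v (\<psi> \<otimes>\<^sub>v c')"
    by (simp add: B_def B'_def flip: matrix_vector_mul_assoc)
  also have "\<dots> \<longleftrightarrow> (\<forall>a b e. ((mat 1 \<otimes>\<^sub>m Q) *v (ext_AE U *v (\<psi> \<otimes>\<^sub>v c))) $ ((a, b), e)
      = (ext_BE (dagger V) *v (\<psi> \<otimes>\<^sub>v c')) $ ((a, b), e))"
    by (auto simp: vec_eq_iff)
  also have "\<dots> \<longleftrightarrow> (\<forall>e. mix Q (\<lambda>e. kraus_op U c e ** vec_matrix \<psi>) e
          = vec_matrix \<psi> ** transpose (kraus_op (dagger V) c' e))"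
    unfolding tensor_one_apply ext_AE_apply ext_BE_apply
    by (auto simp: vec_eq_iff mix_def)
  finally show ?thesis .
qed

text \<open>Conjugating by the invertible matrix of \<psi> pulls it to the left of each Kraus
  operator, where it commutes with mixing and cancels. Transposing leaves the Kraus operators of
  \<open>dagger V\<close> alone on the right.\<close>

lemma reversal_iff_mix_transposed:
  assumes "unitary V" and inv: "vec_matrix \<psi> ** \<Psi>' = mat 1" "\<Psi>' ** vec_matrix \<psi> = mat 1"
  shows "(ext_BE V ** (mat 1 \<otimes>\<^sub>m Q) ** ext_AE U) *v (\<psi> \<otimes>\<^sub>v c) = \<psi> \<otimes>\<^sub>v c'
    \<longleftrightarrow> mix Q (\<lambda>e. transpose (\<Psi>' ** kraus_op U c e ** vec_matrix \<psi>)) = kraus_op (dagger V) c'"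
proof -
  define N where "N e = \<Psi>' ** kraus_op U c e ** vec_matrix \<psi>" for e
  have "kraus_op U c e ** vec_matrix \<psi> = vec_matrix \<psi> ** N e" for e
    by (simp add: N_def matrix_mul_assoc inv)
  then have "(ext_BE V ** (mat 1 \<otimes>\<^sub>m Q) ** ext_AE U) *v (\<psi> \<otimes>\<^sub>v c) = \<psi> \<otimes>\<^sub>v c'
    \<longleftrightarrow> (\<forall>e. vec_matrix \<psi> ** mix Q N e = vec_matrix \<psi> ** transpose (kraus_op (dagger V) c' e))"
    by (simp add: reversal_iff_mix[OF assms(1)] mix_mult_left)
  also have "\<dots> \<longleftrightarrow> (\<forall>e. mix Q N e = transpose (kraus_op (dagger V) c' e))"
    by (metis cancel_inverse_left inv(2))
  also have "\<dots> \<longleftrightarrow> (\<forall>e. transpose (mix Q N e) = kraus_op (dagger V) c' e)"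
    by (metis transpose_transpose)
  finally show ?thesis
    by (simp add: N_def[abs_def] fun_eq_iff mix_transpose)
qed

theorem theorem2p1:
  fixes d :: nat
    and U :: "complex ^ ('a::finite \<times> 'e::finite) ^ ('a::finite \<times> 'e::finite)"
    and V :: "complex ^ ('b::finite \<times> 'e::finite) ^ ('b::finite \<times> 'e::finite)"
    and chi chi' :: "complex ^ 'e"
    and F :: "complex ^ 'a ^ 'a \<Rightarrow> complex ^ 'a ^ 'a"
    and G :: "complex ^ 'b ^ 'b \<Rightarrow> complex ^ 'b ^ 'b"
    and \<sigma> :: "complex ^ 'a ^ 'a"
    and p :: "nat \<Rightarrow> real"
    and ket :: "nat \<Rightarrow> complex ^ 'a"
    and \<theta> :: "complex ^ 'a \<Rightarrow> complex ^ 'a"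
    and W :: "complex ^ 'a ^ 'b"
    and \<psi> :: "complex ^ ('a::finite \<times> 'b::finite)"
  assumes "CARD('a) = d" and "CARD('b) = d"
    and "unitary U" and "unitary V"
    and "unit_vector chi" and "unit_vector chi'"
    and F: "\<And>\<rho>. F \<rho> = ptrace_snd (U ** (\<rho> \<otimes>\<^sub>m ketbra chi chi) ** dagger U)"
    and G: "\<And>\<rho>. G \<rho> = ptrace_snd (dagger V ** (\<rho> \<otimes>\<^sub>m ketbra chi' chi') ** V)"
    and "density_op \<sigma>" and "F \<sigma> = \<sigma>"
    and "orthonormal_basis d ket"
    and "\<And>n. n < d \<Longrightarrow> p n > 0"
    and "\<sigma> = (\<Sum>n<d. p n *\<^sub>R ketbra (ket n) (ket n))"
    and "conjugation \<theta>"
    and "unitary W"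
    and "\<psi> = (\<Sum>n<d. sqrt (p n) *\<^sub>R (ket n \<otimes>\<^sub>v (W *v \<theta> (ket n))))"
  shows "(\<exists>UE :: complex ^ 'e ^ 'e. unitary UE \<and>
            (ext_BE V ** (mat 1 \<otimes>\<^sub>m UE) ** ext_AE U) *v (\<psi> \<otimes>\<^sub>v chi) = \<psi> \<otimes>\<^sub>v chi')
     \<longleftrightarrow> G = unitary_map W \<circ> theta_map \<theta> \<circ> petz F \<sigma> \<circ> theta_map \<theta> \<circ> inv (unitary_map W)"
proof -
  define K where "K = kraus_op U chi"
  define S where "S = spectral_op d ket (\<lambda>n. sqrt (p n))"
  define S' where "S' = spectral_op d ket (\<lambda>n. 1 / sqrt (p n))"
  note ob = \<open>orthonormal_basis d ket\<close>
  note pos = \<open>\<And>n. n < d \<Longrightarrow> p n > 0\<close>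
  obtain J where J: "\<theta> = (\<lambda>v. J *v vconj v)" "unitary J" "mconj J = dagger J"
    using conjugation_matrix[OF \<open>conjugation \<theta>\<close>] .
  \<comment> \<open>Nothing is known about \<open>p n\<close> for \<open>n\<close> at least
    \<open>d\<close>, so the product of the coefficients of \<open>S\<close> and \<open>S'\<close>
    is guaranteed to be 1 only below \<open>d\<close>.\<close>
  have one: "spectral_op d ket q = mat 1" if "\<And>n. n < d \<Longrightarrow> q n = 1" for q
    using that by (subst spectral_op_one[OF ob, symmetric])
      (auto simp: spectral_op_def intro!: sum.cong)
  have SS: "S ** S' = mat 1" "S' ** S = mat 1"
    unfolding S_def S'_def spectral_op_mult[OF ob] by (rule one, use pos in force)+
  have Sh: "dagger S = S" "dagger S' = S'"
    by (simp_all add: S_def S'_def spectral_op_dagger)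
  have sqrt_sigma: "op_sqrt \<sigma> = S"
    using op_sqrt_spectral_op[OF ob pos] \<open>\<sigma> = _\<close> by (simp add: S_def spectral_op_def)
  have FK: "F = kraus_map K"
    by (intro ext) (simp add: F ptrace_dilation K_def)
  have GL: "G = kraus_map (kraus_op (dagger V) chi')"
    by (intro ext) (simp add: G flip: ptrace_dilation)

  \<comment> \<open>With this unitary, \<open>W *v \<theta> v\<close> is
    \<open>w *v vconj v\<close>.\<close>
  define w where "w = W ** J"
  define T where "T = transpose w"
  have w: "dagger w ** w = mat 1" "w ** dagger w = mat 1"
    using unitary_mult[OF \<open>unitary W\<close> J(2)] by (simp_all add: unitary_def w_def)
  have TT: "T ** mconj w = mat 1" "mconj w ** T = mat 1"
    unfolding T_def transpose_dagger[symmetric] matrix_transpose_mul[symmetric] w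
    by (rule transpose_mat)+
  \<comment> \<open>The conjugate in the second tensor factor turns that ket into a bra, so each
    summand is a projector times \<open>T\<close>; weighted by \<open>sqrt (p n)\<close>, the
    projectors add up to \<open>S\<close>.\<close>
  have psi: "vec_matrix \<psi> = S ** T"
  proof -
    have "W *v \<theta> (ket n) = w *v vconj (ket n)" for n
      by (simp add: J(1) w_def matrix_vector_mul_assoc)
    then have "vec_matrix (ket n \<otimes>\<^sub>v (W *v \<theta> (ket n))) = ketbra (ket n) (ket n) ** T" for n
      by (simp add: vec_eq_iff vec_matrix_def tensor_vec_def matrix_mult_entry
          ketbra_def T_def transpose_def matrix_vector_mult_def vconj_def sum_distrib_left mult_ac)
    moreover have "vec_matrix \<psi> = (\<Sum>n<d. sqrt (p n) *\<^sub>R vec_matrix (ket n \<otimes>\<^sub>v (W *v \<theta> (ket n))))"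
      by (simp add: \<open>\<psi> = _\<close> vec_matrix_def vec_eq_iff)
    ultimately show ?thesis
      by (simp add: S_def spectral_op_def matrix_mult_sum_left matrix_scaleR_mult)
  qed
  define P where "P = mconj w ** S'"
  have PP: "vec_matrix \<psi> ** P = mat 1" "P ** vec_matrix \<psi> = mat 1"
  proof -
    have "vec_matrix \<psi> ** P = S ** ((T ** mconj w) ** S')"
      by (simp add: psi P_def matrix_mul_assoc)
    then show "vec_matrix \<psi> ** P = mat 1" by (simp add: TT SS)
    have "P ** vec_matrix \<psi> = mconj w ** ((S' ** S) ** T)"
      by (simp add: psi P_def matrix_mul_assoc)
    then show "P ** vec_matrix \<psi> = mat 1" by (simp add: TT SS)
  qed
  \<comment> \<open>This links the two sides: the time-reversed Petz Kraus operators coincide with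
    the transposed operators of the reversal condition. For the self-adjoint \<open>S\<close> and
    \<open>S'\<close>, conjugation is transposition.\<close>
  have N: "w ** mconj (S ** dagger (K e) ** S') ** dagger w
      = transpose (P ** K e ** vec_matrix \<psi>)" for e
  proof -
    have "mconj S = transpose S" "mconj S' = transpose S'"
      using transpose_dagger[of S] transpose_dagger[of S'] by (simp_all add: Sh)
    moreover have "transpose (mconj w) = dagger w"
      using transpose_dagger[of w] by (metis transpose_transpose)
    ultimately show ?thesis
      by (simp add: P_def psi T_def matrix_transpose_mul mconj_mult mconj_dagger matrix_mul_assoc)
  qed
  have rhs: "unitary_map W \<circ> theta_map \<theta> \<circ> petz F \<sigma> \<circ> theta_map \<theta> \<circ> inv (unitary_map W)
      = kraus_map (\<lambda>e. transpose (P ** K e ** vec_matrix \<psi>))"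
  proof -
    have "petz F \<sigma> = kraus_map (\<lambda>e. S ** dagger (K e) ** S')"
      unfolding FK using \<open>F \<sigma> = \<sigma>\<close> sqrt_sigma SS Sh by (intro petz_kraus_map) (simp_all add: FK)
    then show ?thesis
      by (simp only: N J(1) inv_unitary_map[OF \<open>unitary W\<close>] kraus_map_time_reversed[OF J(2,3)]
          w_def[symmetric])
  qed
  \<comment> \<open>Both sides now compare the same two Kraus families: one says that a unitary
    mixes the first into the second, the other that their maps agree.\<close>
  show ?thesis
    unfolding rhs GL reversal_iff_mix_transposed[OF \<open>unitary V\<close> PP] K_def[symmetric]
      kraus_unitary_freedom[symmetric] by (rule eq_commute)
qed

end
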